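(* Let $(a,b)\in\Delta=\{(a,b): a\ge0,\ b\ge0,\ a+b\le1\}$ be the parameters of the two-dimensional two-state quantum walk, and let $v_{\max}=\max_{j=1,2}\max_{\boldsymbol k\in\mathbb T^2}|v_j(\boldsymbol k)|$ be its maximal speed. Then: (i) $v_{\max}=a+b$; (ii) $\sigma(\hat v_j)=[-v_{\max},v_{\max}]$ for $j=1,2$.
   Context: Parameters: $a_1,a_2\in[0,1]$, $b_j=\sqrt{1-a_j^2}$, $a=a_1a_2$, $b=b_1b_2$. $\mathbb T=\mathbb R/2\pi\mathbb Z$; $C_j=\begin{pmatrix}a_j&b_j\\-b_j&a_j\end{pmatrix}$; $\hat U(\boldsymbol k)=D(k_2)C_2D(k_1)C_1$, $D(\kappa)=\mathrm{diag}(e^{i\kappa},e^{-i\kappa})$ (the Fourier representation of the evolution operator of the walk). For $\boldsymbol k=(k_1,k_2)$: $l_1=k_2+k_1$, $l_2=k_2-k_1$, $c_i=\cos l_i$, $s_i=\sin l_i$, $\tau=ac_1-bc_2$, $\omega=\arccos\tau$; $|\omega_\pm(\boldsymbol k)\rangle$ is an orthonormal eigenbasis of $\hat U(\boldsymbol k)$ for the eigenvalues $e^{\pm i\omega(\boldsymbol k)}$. The group velocity components are $v_1=-\frac{as_1+bs_2}{\sqrt{1-\tau^2}}$, $v_2=-\frac{as_1-bs_2}{\sqrt{1-\tau^2}}$, defined where $\tau^2\neq1$ (a.e.); the maximum in $v_{\max}$ is over such $\boldsymbol k$. The velocity operator $\hat v_j$ is multiplication on $L^2(\mathbb T^2;\mathbb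 C^2)$ by $v_j(\boldsymbol k)\bigl(|\omega_+(\boldsymbol k)\rangle\langle\omega_+(\boldsymbol k)|-|\omega_-(\boldsymbol k)\rangle\langle\omega_-(\boldsymbol k)|\bigr)$; $\sigma(\cdot)$ denotes the spectrum.
   Formalization: Part (ii) is stated only for (a,b) other than (1,0) and (0,1): at these two vertices the velocities are ±1 almost everywhere, the velocity operator squares to the identity and its spectrum lies in {-1,1}, so (ii) fails there; part (i) is kept on all of Δ. *)

theory Defs
  imports "HOL-Analysis.Analysis"
begin

section \<open>The quantum walk in Fourier representation\<close>

definition Delta :: "(real \<times> real) set" where
  "Delta = {(a, b). a \<ge> 0 \<and> b \<ge> 0 \<and> a + b \<le> 1}"

definition compl_par :: "real \<Rightarrow> real" where
  "compl_par a = sqrt (1 - a\<^sup>2)"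

text \<open>The torus \<open>(\<real>/2\<pi>\<int>)\<^sup>2\<close>, each point given by its unique representative in
  \<open>[0, 2\<pi>)\<^sup>2\<close>; \<open>walk\<close>, \<open>tau\<close> and \<open>velocity\<close> below are \<open>2\<pi>\<close>-periodic in both components of \<open>k\<close>.\<close>

definition torus :: "(real ^ 2) set" where
  "torus = {k. \<forall>i. 0 \<le> k $ i \<and> k $ i < 2 * pi}"

definition coin :: "real \<Rightarrow> complex ^ 2 ^ 2" where
  "coin a = vector [vector [of_real a, of_real (compl_par a)],
                    vector [- of_real (compl_par a), of_real a]]"

definition phase_shift :: "real \<Rightarrow> complex ^ 2 ^ 2" where
  "phase_shift \<kappa> = vector [vector [cis \<kappa>, 0], vector [0, cis (- \<kappa>)]]"

definition walk :: "real \<Rightarrow> real \<Rightarrow> real ^ 2 \<Rightarrow> complex ^ 2 ^ 2" where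
  "walk a1 a2 k = phase_shift (k $ 2) ** coin a2 ** phase_shift (k $ 1) ** coin a1"

definition l1 :: "real ^ 2 \<Rightarrow> real" where "l1 k = k $ 2 + k $ 1"

definition l2 :: "real ^ 2 \<Rightarrow> real" where "l2 k = k $ 2 - k $ 1"

definition tau :: "real \<Rightarrow> real \<Rightarrow> real ^ 2 \<Rightarrow> real" where
  "tau a b k = a * cos (l1 k) - b * cos (l2 k)"

definition omega :: "real \<Rightarrow> real \<Rightarrow> real ^ 2 \<Rightarrow> real" where
  "omega a b k = arccos (tau a b k)"

definition regular_points :: "real \<Rightarrow> real \<Rightarrow> (real ^ 2) set" where
  "regular_points a b = {k \<in> torus. (tau a b k)\<^sup>2 \<noteq> 1}"

text \<open>The component index has the two-element type \<open>2\<close>.  Outside \<open>regular_points a b\<close>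
  the value is \<open>0\<close> by the convention \<open>x / 0 = 0\<close>; these points form a null set.\<close>

definition velocity :: "real \<Rightarrow> real \<Rightarrow> 2 \<Rightarrow> real ^ 2 \<Rightarrow> real" where
  "velocity a b j k =
     (if j = 1 then - (a * sin (l1 k) + b * sin (l2 k)) / sqrt (1 - (tau a b k)\<^sup>2)
      else - (a * sin (l1 k) - b * sin (l2 k)) / sqrt (1 - (tau a b k)\<^sup>2))"

definition vmax :: "real \<Rightarrow> real \<Rightarrow> real" where
  "vmax a b = Max (range (\<lambda>j :: 2.
     GREATEST s. s \<in> (\<lambda>k. \<bar>velocity a b j k\<bar>) ` regular_points a b))"

definition cinner2 :: "complex ^ 2 \<Rightarrow> complex ^ 2 \<Rightarrow> complex" where
  "cinner2 u w = (\<Sum>i\<in>UNIV. cnj (u $ i) * w $ i)"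

definition ketbra :: "complex ^ 2 \<Rightarrow> complex ^ 2 \<Rightarrow> complex ^ 2 ^ 2" where
  "ketbra u w = (\<chi> i j. u $ i * cnj (w $ j))"

definition walk_eigenbasis ::
  "real \<Rightarrow> real \<Rightarrow> (real ^ 2 \<Rightarrow> complex ^ 2) \<Rightarrow> (real ^ 2 \<Rightarrow> complex ^ 2) \<Rightarrow> bool" where
  "walk_eigenbasis a1 a2 \<psi>p \<psi>m \<longleftrightarrow>
     (\<forall>k \<in> torus.
        (let \<omega> = omega (a1 * a2) (compl_par a1 * compl_par a2) k in
         cinner2 (\<psi>p k) (\<psi>p k) = 1 \<and> cinner2 (\<psi>m k) (\<psi>m k) = 1 \<and>
         cinner2 (\<psi>p k) (\<psi>m k) = 0 \<and>
         walk a1 a2 k *v \<psi>p k = cis \<omega> *s \<psi>p k \<and>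
         walk a1 a2 k *v \<psi>m k = cis (- \<omega>) *s \<psi>m k))"


section \<open>Spectra of operators on the square-integrable spinors on the torus\<close>

text \<open>An element of \<open>L\<^sup>2(T\<^sup>2; C\<^sup>2)\<close> is given by a representative in \<open>L2\<close>; the equality of the
  Hilbert space is \<open>L2_eq\<close>.  Accordingly, operators act on representatives and operator
  identities are required up to \<open>L2_eq\<close>.\<close>

definition torus_measure :: "(real ^ 2) measure" where
  "torus_measure = lebesgue_on torus"

definition L2 :: "(real ^ 2 \<Rightarrow> complex ^ 2) set" where
  "L2 = {f \<in> borel_measurable torus_measure. integrable torus_measure (\<lambda>k. (norm (f k))\<^sup>2)}"

definition L2_norm :: "(real ^ 2 \<Rightarrow> complex ^ 2) \<Rightarrow> real" where
  "L2_norm f = sqrt (\<integral>k. (norm (f k))\<^sup>2 \<partial>torus_measure)"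

definition L2_eq :: "(real ^ 2 \<Rightarrow> complex ^ 2) \<Rightarrow> (real ^ 2 \<Rightarrow> complex ^ 2) \<Rightarrow> bool" where
  "L2_eq f g \<longleftrightarrow> (AE k in torus_measure. f k = g k)"

type_synonym spinor_op = "(real ^ 2 \<Rightarrow> complex ^ 2) \<Rightarrow> (real ^ 2 \<Rightarrow> complex ^ 2)"

definition bounded_L2_op :: "spinor_op \<Rightarrow> bool" where
  "bounded_L2_op R \<longleftrightarrow>
     (\<forall>f \<in> L2. R f \<in> L2) \<and>
     (\<forall>f \<in> L2. \<forall>g \<in> L2. L2_eq f g \<longrightarrow> L2_eq (R f) (R g)) \<and>
     (\<forall>f \<in> L2. \<forall>g \<in> L2. L2_eq (R (\<lambda>k. f k + g k)) (\<lambda>k. R f k + R g k)) \<and>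
     (\<forall>c. \<forall>f \<in> L2. L2_eq (R (\<lambda>k. c *s f k)) (\<lambda>k. c *s R f k)) \<and>
     (\<exists>C. \<forall>f \<in> L2. L2_norm (R f) \<le> C * L2_norm f)"

definition shift_op :: "spinor_op \<Rightarrow> complex \<Rightarrow> spinor_op" where
  "shift_op A z f = (\<lambda>k. A f k - z *s f k)"

definition L2_resolvent_set :: "spinor_op \<Rightarrow> complex set" where
  "L2_resolvent_set A =
     {z. \<exists>R. bounded_L2_op R \<and>
             (\<forall>f \<in> L2. L2_eq (R (shift_op A z f)) f \<and> L2_eq (shift_op A z (R f)) f)}"

definition L2_spectrum :: "spinor_op \<Rightarrow> complex set" where
  "L2_spectrum A = - L2_resolvent_set A"

text \<open>For \<open>(a, b)\<close> equal to \<open>(1, 0)\<close> or \<open>(0, 1)\<close> the velocities only take the values \<open>1\<close> and \<open>-1\<close>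
  on \<open>regular_points a b\<close>, so that the operator below squares to the identity and its
  spectrum is \<open>{-1, 1}\<close> instead of an interval.\<close>

definition velocity_op ::
  "real \<Rightarrow> real \<Rightarrow> (real ^ 2 \<Rightarrow> complex ^ 2) \<Rightarrow> (real ^ 2 \<Rightarrow> complex ^ 2) \<Rightarrow> 2 \<Rightarrow> spinor_op" where
  "velocity_op a b \<psi>p \<psi>m j f =
     (\<lambda>k. (velocity a b j k *\<^sub>R (ketbra (\<psi>p k) (\<psi>p k) - ketbra (\<psi>m k) (\<psi>m k))) *v f k)"


section \<open>Non-vacuity of the parametrisation and of the eigenbasis hypothesis\<close>

lemma Delta_realised:
  assumes "(a, b) \<in> Delta"
  shows "\<exists>a1\<in>{0..1}. \<exists>a2\<in>{0..1}. a = a1 * a2 \<and> b = compl_par a1 * compl_par a2"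
proof -
  have ab: "a \<ge> 0" "b \<ge> 0" "a + b \<le> 1" using assms by (auto simp: Delta_def)
  define p where "p = arccos (a + b)"
  define q where "q = arccos (a - b)"
  have cp: "cos p = a + b" and cq: "cos q = a - b"
    using ab by (auto simp: p_def q_def intro!: cos_arccos)
  have p0: "0 \<le> p" using ab by (auto simp: p_def intro!: arccos_lbound)
  have pq: "p \<le> q" unfolding p_def q_def using ab by (intro arccos_le_arccos) auto
  have "p \<le> arccos (- (a - b))"
    unfolding p_def using ab by (intro arccos_le_arccos) auto
  also have "\<dots> = pi - q" unfolding q_def using ab by (intro arccos_minus) auto
  finally have pq_pi: "p + q \<le> pi" by simp
  define s where "s = (q + p) / 2"
  define t where "t = (q - p) / 2"
  have st: "0 \<le> s" "s \<le> pi / 2" "0 \<le> t" "t \<le> pi / 2"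
    using p0 pq pq_pi by (auto simp: s_def t_def)
  have c: "0 \<le> cos s" "0 \<le> cos t" using st by (auto intro!: cos_ge_zero)
  have sn: "0 \<le> sin s" "0 \<le> sin t" using st by (auto intro!: sin_ge_zero)
  have "s - t = p" "s + t = q" by (auto simp: s_def t_def field_simps)
  then have e: "cos s * cos t + sin s * sin t = a + b" "cos s * cos t - sin s * sin t = a - b"
    using cp cq cos_diff[of s t] cos_add[of s t] by auto
  have cc: "compl_par (cos s) = sin s" "compl_par (cos t) = sin t"
    using sn by (auto simp: compl_par_def sin_squared_eq[symmetric])
  show ?thesis
    by (rule bexI[of _ "cos s"], rule bexI[of _ "cos t"]) (use e c cc in auto)
qed

lemma walk_eigenbasis_exists:
  assumes "a1 \<in> {0..1}" "a2 \<in> {0..1}"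
  shows "\<exists>\<psi>p \<psi>m. walk_eigenbasis a1 a2 \<psi>p \<psi>m"
proof -
  define b1 where "b1 = compl_par a1"
  define b2 where "b2 = compl_par a2"
  have n1: "a1\<^sup>2 + b1\<^sup>2 = 1" and n2: "a2\<^sup>2 + b2\<^sup>2 = 1"
    using assms by (auto simp: b1_def b2_def compl_par_def abs_square_le_1)
  have "\<exists>\<psi> \<phi>. cinner2 \<psi> \<psi> = 1 \<and> cinner2 \<phi> \<phi> = 1 \<and> cinner2 \<psi> \<phi> = 0 \<and>
      walk a1 a2 k *v \<psi> = cis (omega (a1 * a2) (b1 * b2) k) *s \<psi> \<and>
      walk a1 a2 k *v \<phi> = cis (- omega (a1 * a2) (b1 * b2) k) *s \<phi>" for k
  proof -
    define p where "p = of_real (a1 * a2) * cis (l1 k) - of_real (b1 * b2) * cis (l2 k)"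
    define q where "q = of_real (b1 * a2) * cis (l1 k) + of_real (a1 * b2) * cis (l2 k)"
    have cl: "cis (l1 k) = cis (k $ 2) * cis (k $ 1)" "cis (l2 k) = cis (k $ 2) * cis (- k $ 1)"
      "cis (- l1 k) = cis (- k $ 2) * cis (- k $ 1)" "cis (- l2 k) = cis (- k $ 2) * cis (k $ 1)"
      by (simp_all add: l1_def l2_def cis_mult)
    have U: "walk a1 a2 k = vector [vector [p, q], vector [- cnj q, cnj p]]"
      unfolding walk_def phase_shift_def coin_def p_def q_def b1_def b2_def
      by (simp add: vec_eq_iff forall_2 matrix_matrix_mult_def sum_2 cis_cnj cl algebra_simps)
    have cs: "cos (l1 k) * cos (l1 k) + sin (l1 k) * sin (l1 k) = 1"
      "cos (l2 k) * cos (l2 k) + sin (l2 k) * sin (l2 k) = 1"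
      using sin_cos_squared_add[of "l1 k"] sin_cos_squared_add[of "l2 k"]
      by (auto simp: power2_eq_square)
    have reim: "Re p = a1 * a2 * cos (l1 k) - b1 * b2 * cos (l2 k)"
      "Im p = a1 * a2 * sin (l1 k) - b1 * b2 * sin (l2 k)"
      "Re q = b1 * a2 * cos (l1 k) + a1 * b2 * cos (l2 k)"
      "Im q = b1 * a2 * sin (l1 k) + a1 * b2 * sin (l2 k)"
      by (simp_all add: p_def q_def)
    have det_re: "(Re p)\<^sup>2 + (Im p)\<^sup>2 + ((Re q)\<^sup>2 + (Im q)\<^sup>2) = 1"
    proof -
      have "(Re p)\<^sup>2 + (Im p)\<^sup>2 + ((Re q)\<^sup>2 + (Im q)\<^sup>2)
        = (a2\<^sup>2 * (a1\<^sup>2 + b1\<^sup>2)) * (cos (l1 k) * cos (l1 k) + sin (l1 k) * sin (l1 k))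
        + (b2\<^sup>2 * (a1\<^sup>2 + b1\<^sup>2)) * (cos (l2 k) * cos (l2 k) + sin (l2 k) * sin (l2 k))"
        unfolding reim by algebra
      then show ?thesis using n1 n2 cs by simp
    qed
    have rep: "Re p = tau (a1 * a2) (b1 * b2) k" by (simp add: p_def tau_def)
    have "(Re p)\<^sup>2 \<le> 1" using det_re by (smt (verit) zero_le_power2)
    then have "\<bar>Re p\<bar> \<le> 1" by (simp add: abs_square_le_1)
    define w where "w = omega (a1 * a2) (b1 * b2) k"
    define m where "m = cis w"
    have rem: "Re m = Re p"
      unfolding m_def w_def omega_def rep[symmetric] using \<open>\<bar>Re p\<bar> \<le> 1\<close> by (simp add: cos_arccos_abs)
    have mm: "m * cnj m = 1" by (simp add: m_def cis_cnj cis_mult)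
    have nm: "(Re m)\<^sup>2 + (Im m)\<^sup>2 = 1" by (simp add: m_def)
    have "\<exists>x y. (x, y) \<noteq> (0, 0) \<and> p * x + q * y = m * x \<and> - cnj q * x + cnj p * y = m * y"
    proof (cases "q = 0")
      case True
      have "(Im m)\<^sup>2 = (Im p)\<^sup>2" using det_re nm rem True by simp
      then have "Im m = Im p \<or> Im m = - Im p" by (simp add: power2_eq_iff)
      then have "m = p \<or> m = cnj p" using rem by (auto simp: complex_eq_iff)
      then show ?thesis
      proof
        assume "m = p"
        then show ?thesis using True by (intro exI[of _ 1] exI[of _ 0]) simp
      next
        assume "m = cnj p"
        then show ?thesis using True by (intro exI[of _ 0] exI[of _ 1]) simp
      qed
    next
      case False
      have "p + cnj p = m + cnj m" using rem by (simp add: complex_eq_iff)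
      moreover have "p * cnj p + q * cnj q = 1"
        using det_re by (simp add: complex_eq_iff power2_eq_square)
      ultimately have "- cnj q * q + cnj p * (m - p) = m * (m - p)"
        using mm by algebra
      then show ?thesis using False
        by (intro exI[of _ q] exI[of _ "m - p"]) (simp add: algebra_simps)
    qed
    then obtain x y where xy: "(x, y) \<noteq> (0, 0)" "p * x + q * y = m * x"
      "- cnj q * x + cnj p * y = m * y" by blast
    define N where "N = sqrt ((cmod x)\<^sup>2 + (cmod y)\<^sup>2)"
    have "(cmod x)\<^sup>2 + (cmod y)\<^sup>2 > 0"
      using xy(1) by (auto simp: sum_power2_gt_zero_iff)
    then have N: "N > 0" "N\<^sup>2 = (cmod x)\<^sup>2 + (cmod y)\<^sup>2" by (auto simp: N_def)
    define X where "X = x / of_real N"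
    define Y where "Y = y / of_real N"
    have XY: "p * X + q * Y = m * X" "- cnj q * X + cnj p * Y = m * Y"
      using xy(2,3) N by (auto simp: X_def Y_def field_simps)
    have "(cmod X)\<^sup>2 + (cmod Y)\<^sup>2 = ((cmod x)\<^sup>2 + (cmod y)\<^sup>2) / N\<^sup>2"
      by (simp add: X_def Y_def norm_divide power_divide add_divide_distrib)
    then have "(cmod X)\<^sup>2 + (cmod Y)\<^sup>2 = 1"
      unfolding N(2)[symmetric] using N(1) by simp
    then have "of_real ((cmod X)\<^sup>2 + (cmod Y)\<^sup>2) = (1 :: complex)" by (simp only: of_real_1)
    then have nXY: "X * cnj X + Y * cnj Y = 1" by (simp only: of_real_add complex_norm_square)
    have XYc: "cnj p * cnj X + cnj q * cnj Y = cnj m * cnj X"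
      "- q * cnj X + p * cnj Y = cnj m * cnj Y"
      using arg_cong[OF XY(1), of cnj] arg_cong[OF XY(2), of cnj] by auto
    show ?thesis
      using XY XYc nXY
      by (intro exI[of _ "vector [X, Y]"] exI[of _ "vector [- cnj Y, cnj X]"])
        (simp add: U cinner2_def sum_2 vec_eq_iff forall_2 matrix_vector_mult_def
          flip: w_def cis_cnj m_def, simp add: m_def cis_cnj algebra_simps)
  qed
  then show ?thesis
    unfolding walk_eigenbasis_def Let_def b1_def b2_def by metis
qed

end

theory Submission
  imports Defs
begin

text \<open>
  With \<open>\<tau> = a c\<^sub>1 - b c\<^sub>2\<close>, the numerator \<open>n\<close> of a velocity satisfies
  \<open>(a + b)\<^sup>2 (1 - \<tau>\<^sup>2) - n\<^sup>2 \<ge> 2 a b (1 + cos (l\<^sub>1 \<plusminus> l\<^sub>2)) \<ge> 0\<close>, where \<open>a + b \<le> 1\<close> is used. Equality holds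
  at \<open>(0, \<pi>/2)\<close> for \<open>v\<^sub>1\<close> and at \<open>(\<pi>/2, 0)\<close> for \<open>v\<^sub>2\<close>, where \<open>\<tau> = 0\<close>. Along the segment from the
  origin to this point, which is regular unless \<open>|a - b| = 1\<close>, the speed varies continuously from
  \<open>0\<close> to \<open>a + b\<close>, so it takes all values in between.

  The velocity operator is multiplication by \<open>V = v P\<close>, where \<open>P\<close> is the difference of the two
  eigenprojections. From \<open>U = \<tau> + i sqrt (1 - \<tau>\<^sup>2) P\<close> one sees that \<open>V\<close> is measurable, and continuous
  at the regular points, even if the eigenvectors are chosen badly. Since \<open>P\<^sup>2 = 1\<close>, the resolvent
  at \<open>z\<close> is multiplication by \<open>(V + z) / (v\<^sup>2 - z\<^sup>2)\<close> whenever \<open>v\<^sup>2\<close> stays away from \<open>z\<^sup>2\<close>. Conversely,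
  an eigenvalue of \<open>V\<close> at a regular point is in the spectrum: localise a constant
  eigenvector near this point.
\<close>

section \<open>Multiplication operators\<close>

lemma norm_vector_smult: "norm (c *s x) = cmod c * norm x" for x :: "complex ^ 'n"
  by (simp add: norm_vec_def norm_mult L2_set_def power_mult_distrib real_sqrt_mult
      flip: sum_distrib_left)

text \<open>Each coordinate embedding \<open>axis i\<close> is continuous, and a vector is the sum
  of its embedded coordinates.\<close>

lemma borel_measurable_vec_componentwise:
  fixes f :: "'a \<Rightarrow> complex ^ 'n"
  assumes "\<And>i. (\<lambda>x. f x $ i) \<in> borel_measurable M"
  shows "f \<in> borel_measurable M"
proof -
  have "continuous_on UNIV (\<lambda>c :: complex. axis i c :: complex ^ 'n)" for i :: 'n
    unfolding axis_def
  proof (intro continuous_on_vec_lambda)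
    show "continuous_on UNIV (\<lambda>c :: complex. if l = i then c else 0)" for l
      by (cases "l = i") auto
  qed
  then have "(\<lambda>x. \<Sum>i\<in>UNIV. axis i (f x $ i)) \<in> borel_measurable M"
    by (intro borel_measurable_sum) (rule borel_measurable_continuous_on[OF _ assms])
  moreover have "(\<Sum>i\<in>UNIV. axis i (f x $ i)) = f x" for x
    by (simp add: vec_eq_iff axis_def)
  ultimately show ?thesis by simp
qed

lemma borel_measurable_vec_nth: "(\<lambda>x :: complex ^ 'n. x $ i) \<in> borel_measurable borel"
  by (intro borel_measurable_continuous_onI continuous_intros)

text \<open>The open box supplies open subsets of the half-open square; the closed one gives
  boundedness and contains the boundary points, which are limits of the open box.\<close>

lemma torus_between: "box 0 (\<chi> i. 2 * pi) \<subseteq> torus" "torus \<subseteq> cbox 0 (\<chi> i. 2 * pi)"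
  by (auto simp: torus_def mem_box_cart less_imp_le)

lemma torus_sets [measurable, simp]: "torus \<in> sets lebesgue"
proof -
  have "torus = (\<Inter>i. {k. 0 \<le> k $ i} \<inter> {k. k $ i < 2 * pi})"
    by (auto simp: torus_def)
  also have "\<dots> \<in> sets borel"
    by (intro sets.countable_INT'' sets.Int borel_closed borel_open
        closed_Collect_le open_Collect_less continuous_intros) auto
  finally show ?thesis by simp
qed

lemma space_torus_measure [simp]: "space torus_measure = torus"
  by (simp add: torus_measure_def)

lemma borel_imp_torus_measurable:
  "f \<in> borel_measurable borel \<Longrightarrow> f \<in> borel_measurable torus_measure"
  unfolding torus_measure_def
  by (intro measurable_restrict_space1 measurable_completion) simp

lemma AE_torusI: "(\<And>k. k \<in> torus \<Longrightarrow> P k) \<Longrightarrow> AE k in torus_measure. P k"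
  by (intro AE_I2) simp

lemma L2_boundedI:
  assumes f: "f \<in> L2" and g: "g \<in> borel_measurable torus_measure"
    and le: "\<And>k. k \<in> torus \<Longrightarrow> norm (g k) \<le> K * norm (f k)"
  shows "g \<in> L2" and "K \<ge> 0 \<Longrightarrow> L2_norm g \<le> K * L2_norm f"
proof -
  have int: "integrable torus_measure (\<lambda>k. K\<^sup>2 * (norm (f k))\<^sup>2)"
    using f by (auto simp: L2_def)
  have sq: "(norm (g k))\<^sup>2 \<le> K\<^sup>2 * (norm (f k))\<^sup>2" if "k \<in> torus" for k
    using power_mono[OF le[OF that], of 2] by (simp add: power_mult_distrib)
  have int_g: "integrable torus_measure (\<lambda>k. (norm (g k))\<^sup>2)"
    using sq g by (intro Bochner_Integration.integrable_bound[OF int] AE_torusI) auto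
  then show "g \<in> L2" using g by (simp add: L2_def)
  have "(\<integral>k. (norm (g k))\<^sup>2 \<partial>torus_measure) \<le> (\<integral>k. K\<^sup>2 * (norm (f k))\<^sup>2 \<partial>torus_measure)"
    using sq by (intro integral_mono_AE int int_g AE_torusI) auto
  then have "L2_norm g \<le> sqrt (K\<^sup>2 * (\<integral>k. (norm (f k))\<^sup>2 \<partial>torus_measure))"
    unfolding L2_norm_def by simp
  then show "L2_norm g \<le> K * L2_norm f" if "K \<ge> 0"
    using that by (simp add: L2_norm_def real_sqrt_mult)
qed

lemma L2_norm_cong: "L2_eq f g \<Longrightarrow> f \<in> L2 \<Longrightarrow> g \<in> L2 \<Longrightarrow> L2_norm f = L2_norm g"
  unfolding L2_norm_def L2_eq_def L2_def
  by (intro arg_cong[of _ _ sqrt] integral_cong_AE) auto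

text \<open>The bound is imposed at every point of the torus, not just almost everywhere, so it can
  be applied pointwise. Measurability is asked entrywise because \<open>velocity_op_entry\<close>
  describes the velocity operator by its entries.\<close>

definition bounded_multiplier :: "(real ^ 2 \<Rightarrow> complex ^ 2 ^ 2) \<Rightarrow> bool" where
  "bounded_multiplier W \<longleftrightarrow>
     (\<forall>i j. (\<lambda>k. W k $ i $ j) \<in> borel_measurable torus_measure) \<and>
     (\<exists>K\<ge>0. \<forall>k\<in>torus. \<forall>x. norm (W k *v x) \<le> K * norm x)"

lemma multiplier_L2:
  assumes "bounded_multiplier W"
  shows "f \<in> L2 \<Longrightarrow> (\<lambda>k. W k *v f k) \<in> L2"
    and "\<exists>C. \<forall>f\<in>L2. L2_norm (\<lambda>k. W k *v f k) \<le> C * L2_norm f"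
proof -
  obtain K where K: "K \<ge> 0" "\<And>k x. k \<in> torus \<Longrightarrow> norm (W k *v x) \<le> K * norm x"
    using assms by (auto simp: bounded_multiplier_def)
  have meas: "(\<lambda>k. W k *v f k) \<in> borel_measurable torus_measure" if "f \<in> L2" for f
  proof (rule borel_measurable_vec_componentwise)
    have f: "f \<in> borel_measurable torus_measure"
      using that by (simp add: L2_def)
    have "(\<lambda>k. f k $ j) \<in> borel_measurable torus_measure" for j
      by (rule measurable_compose[OF f borel_measurable_vec_nth])
    moreover have "(\<lambda>k. W k $ i $ j) \<in> borel_measurable torus_measure" for i j
      using assms by (simp add: bounded_multiplier_def)
    ultimately show "(\<lambda>k. (W k *v f k) $ i) \<in> borel_measurable torus_measure" for i
      unfolding matrix_vector_mult_def vec_lambda_beta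
      by (intro borel_measurable_sum borel_measurable_times)
  qed
  show "(\<lambda>k. W k *v f k) \<in> L2" if "f \<in> L2"
    by (rule L2_boundedI(1)[OF that meas[OF that] K(2)])
  show "\<exists>C. \<forall>f\<in>L2. L2_norm (\<lambda>k. W k *v f k) \<le> C * L2_norm f"
  proof (intro exI ballI)
    show "L2_norm (\<lambda>k. W k *v f k) \<le> K * L2_norm f" if "f \<in> L2" for f
      by (rule L2_boundedI(2)[OF that meas[OF that] K(2,1)])
  qed
qed

lemma matrix_vector_mult_smult: "A *v (c *s x) = c *s (A *v x)" for A :: "complex ^ 'n ^ 'm"
  by (simp add: vec_eq_iff matrix_vector_mult_def sum_distrib_left mult.left_commute)

lemma scaleR_matrix_smult: "(c *\<^sub>R A) *v x = complex_of_real c *s (A *v x)" for A :: "complex ^ 'n ^ 'm"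
proof -
  have "(c *\<^sub>R A) $ i $ l * x $ l = of_real c * (A $ i $ l * x $ l)" for i l
    by (simp add: scaleR_conv_of_real[where 'a = complex])
  then show ?thesis
    unfolding vec_eq_iff matrix_vector_mult_def
    by (simp only: vec_lambda_beta vector_smult_component sum_distrib_left) simp
qed

lemma multiplier_bounded_L2_op:
  assumes "bounded_multiplier W"
  shows "bounded_L2_op (\<lambda>f k. W k *v f k)"
  unfolding bounded_L2_op_def L2_eq_def
proof (intro conjI ballI allI impI)
  show "\<exists>C. \<forall>f\<in>L2. L2_norm (\<lambda>k. W k *v f k) \<le> C * L2_norm f"
    by (rule multiplier_L2(2)[OF assms])
  show "AE k in torus_measure. W k *v f k = W k *v g k"
    if "AE k in torus_measure. f k = g k" for f g :: "real ^ 2 \<Rightarrow> complex ^ 2"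
    using that by (rule eventually_mono) simp
  show "AE k in torus_measure. W k *v (f k + g k) = W k *v f k + W k *v g k"
    for f g :: "real ^ 2 \<Rightarrow> complex ^ 2"
    by (rule AE_torusI) (rule matrix_vector_right_distrib)
  show "AE k in torus_measure. W k *v (c *s f k) = c *s (W k *v f k)"
    for c and f :: "real ^ 2 \<Rightarrow> complex ^ 2"
    by (rule AE_torusI) (rule matrix_vector_mult_smult)
qed (rule multiplier_L2(1)[OF assms])

text \<open>A bounded pointwise inverse of \<open>V k - z\<close> acts as the resolvent; both
  operator identities then hold at every point and hence almost everywhere.\<close>

lemma multiplier_resolvent:
  assumes "bounded_multiplier W"
    and "\<And>k x. k \<in> torus \<Longrightarrow> W k *v (V k *v x - z *s x) = x"
    and "\<And>k x. k \<in> torus \<Longrightarrow> V k *v (W k *v x) - z *s (W k *v x) = x"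
  shows "z \<in> L2_resolvent_set (\<lambda>f k. V k *v f k)"
  unfolding L2_resolvent_set_def mem_Collect_eq
  by (intro exI[of _ "\<lambda>f k. W k *v f k"] conjI ballI multiplier_bounded_L2_op[OF assms(1)])
    (unfold L2_eq_def shift_op_def, (rule AE_torusI, simp only: assms(2,3))+)

text \<open>Provides the test functions that refute a bounded resolvent. A nonempty open set is not
  negligible, and inside the bounded torus its measure is finite.\<close>

lemma L2_indicator_open:
  fixes w :: "complex ^ 2"
  assumes E: "open E" "E \<noteq> {}" "E \<subseteq> torus" and w: "w \<noteq> 0"
  shows "(\<lambda>k. indicator E k *\<^sub>R w) \<in> L2" and "L2_norm (\<lambda>k. indicator E k *\<^sub>R w) > 0"
proof -
  have bE: "bounded E"
    using E(3) torus_between(2) bounded_cbox bounded_subset by blast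
  have lm: "E \<in> lmeasurable"
    using E(1) bE by (simp add: lmeasurable_open)
  have meas: "measure lebesgue E > 0"
    using open_not_negligible[OF E(1,2)] lm
    by (simp add: negligible_iff_measure zero_less_measure_iff)
  have EM: "E \<in> sets torus_measure" "emeasure torus_measure E < \<infinity>"
    using lm E(3) unfolding torus_measure_def
    by (auto simp: sets_restrict_space_iff emeasure_restrict_space fmeasurable_def)
  have sq: "(norm (indicator E k *\<^sub>R w))\<^sup>2 = (norm w)\<^sup>2 * indicator E k" for k
    by (auto simp: indicator_def)
  show "(\<lambda>k. indicator E k *\<^sub>R w) \<in> L2"
    unfolding L2_def mem_Collect_eq sq using EM by auto
  have "measure torus_measure E = measure lebesgue E"
    unfolding torus_measure_def using lm E(3) by (intro measure_restrict_space) auto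
  then show "L2_norm (\<lambda>k. indicator E k *\<^sub>R w) > 0"
    unfolding L2_norm_def sq using meas w E(3) by (simp add: Int_absorb2)
qed

text \<open>A point \<open>k0\<close> on the boundary of the half-open square still lies in the closure of the
  interior, so every ball around \<open>k0\<close> contains an open part of the torus that supports a
  test function.\<close>

lemma multiplier_eigenvalue_in_spectrum:
  assumes V: "bounded_multiplier V" and k0: "k0 \<in> torus"
    and cont: "continuous (at k0 within torus) (\<lambda>k. V k *v w)"
    and eig: "V k0 *v w = z *s w" and w: "w \<noteq> 0"
  shows "z \<in> L2_spectrum (\<lambda>f k. V k *v f k)"
proof (rule ccontr)
  let ?A = "\<lambda>f k. V k *v f k"
  assume "z \<notin> L2_spectrum ?A"
  then obtain R where R: "bounded_L2_op R" and inv: "\<And>f. f \<in> L2 \<Longrightarrow> L2_eq (R (shift_op ?A z f)) f"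
    unfolding L2_spectrum_def L2_resolvent_set_def by blast
  obtain C where C: "\<And>f. f \<in> L2 \<Longrightarrow> L2_norm (R f) \<le> C * L2_norm f"
  proof -
    have "\<exists>C. \<forall>f\<in>L2. L2_norm (R f) \<le> C * L2_norm f"
      using R unfolding bounded_L2_op_def by (elim conjE)
    then show thesis using that by blast
  qed
  \<comment> \<open>A bounded inverse \<open>R\<close> would give a test function \<open>f\<close> a
    norm of at most \<open>\<bar>C\<bar> * \<epsilon>\<close> times itself, so this factor is made
    smaller than 1. The absolute value covers a negative \<open>C\<close>.\<close>
  define \<epsilon> where "\<epsilon> = 1 / (\<bar>C\<bar> + 1)"
  have \<epsilon>: "\<epsilon> > 0" "\<bar>C\<bar> * \<epsilon> < 1" by (auto simp: \<epsilon>_def field_simps)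
  obtain d where d: "d > 0"
    "\<And>k. k \<in> torus \<Longrightarrow> dist k k0 < d \<Longrightarrow> norm (V k *v w - z *s w) < \<epsilon> * norm w"
  proof -
    have "\<epsilon> * norm w > 0" using w \<epsilon>(1) by simp
    then show thesis
      using cont that unfolding continuous_within_eps_delta eig dist_norm by blast
  qed
  define E where "E = box 0 (\<chi> i. 2 * pi) \<inter> ball k0 d"
  have E: "open E" "E \<subseteq> torus" using torus_between by (auto simp: E_def)
  \<comment> \<open>The centre of the square shows that the open box is nonempty, as the formula for
    its closure requires.\<close>
  have "(\<chi> i. pi) \<in> box 0 (\<chi> i :: 2. 2 * pi)" by (simp add: mem_box_cart)
  then have "k0 \<in> closure (box 0 (\<chi> i. 2 * pi))"
    using k0 torus_between(2) by (subst closure_box) auto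
  then have "E \<noteq> {}"
    using d(1) open_Int_closure_eq_empty[of "ball k0 d" "box 0 (\<chi> i. 2 * pi)"]
      centre_in_ball[of k0 d] unfolding E_def by blast
  define f where "f = (\<lambda>k. indicator E k *\<^sub>R w)"
  have f: "f \<in> L2" "L2_norm f > 0"
    using L2_indicator_open[OF E(1) \<open>E \<noteq> {}\<close> E(2) w] by (auto simp: f_def)
  define h where "h = shift_op ?A z f"
  have hm: "h \<in> borel_measurable torus_measure"
  proof -
    have "(\<lambda>k. z *s f k) \<in> borel_measurable torus_measure"
    proof (rule borel_measurable_vec_componentwise)
      have "(\<lambda>k. f k $ i) \<in> borel_measurable torus_measure" for i
        using f(1) by (intro measurable_compose[OF _ borel_measurable_vec_nth]) (simp add: L2_def)
      then show "(\<lambda>k. (z *s f k) $ i) \<in> borel_measurable torus_measure" for i by simp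
    qed
    moreover have "(\<lambda>k. V k *v f k) \<in> borel_measurable torus_measure"
      using multiplier_L2(1)[OF V f(1)] by (simp add: L2_def)
    ultimately show ?thesis unfolding h_def shift_op_def by simp
  qed
  \<comment> \<open>Off \<open>E\<close> both sides vanish; on \<open>E\<close> the choice of
    \<open>d\<close> applies.\<close>
  have "norm (h k) \<le> \<epsilon> * norm (f k)" if "k \<in> torus" for k
    using d(2)[OF that] by (auto simp: h_def f_def shift_op_def indicator_def E_def dist_commute
        intro: less_imp_le)
  then have h: "h \<in> L2" "L2_norm h \<le> \<epsilon> * L2_norm f"
    using L2_boundedI[OF f(1) hm] \<epsilon>(1) by auto
  have "R h \<in> L2" using R h(1) by (simp add: bounded_L2_op_def)
  then have "L2_norm f = L2_norm (R h)"
    using L2_norm_cong[OF inv[OF f(1)]] f(1) by (simp add: h_def)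
  also have "\<dots> \<le> \<bar>C\<bar> * L2_norm h"
  proof -
    have "L2_norm h \<ge> 0" by (simp add: L2_norm_def)
    then have "C * L2_norm h \<le> \<bar>C\<bar> * L2_norm h" by (intro mult_right_mono) auto
    with C[OF h(1)] show ?thesis by linarith
  qed
  also have "\<dots> \<le> \<bar>C\<bar> * \<epsilon> * L2_norm f"
    using mult_left_mono[OF h(2), of "\<bar>C\<bar>"] by simp
  also have "\<dots> < L2_norm f" using \<epsilon>(2) f(2) by simp
  finally show False by simp
qed

section \<open>Spectral decomposition of a unitary matrix\<close>

text \<open>Let \<open>M\<close> have the columns \<open>p\<close> and \<open>m\<close>.
  Orthonormality says that the adjoint \<open>M'\<close> is a left inverse, hence also a right
  inverse of this square matrix, and \<open>M ** M'\<close> is the sum of the two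
  projections.\<close>

lemma orthonormal_resolution:
  assumes "cinner2 p p = 1" "cinner2 m m = 1" "cinner2 p m = 0"
  shows "ketbra p p + ketbra m m = mat 1"
proof -
  define M :: "complex ^ 2 ^ 2" where "M = (\<chi> i j. if j = 1 then p $ i else m $ i)"
  define M' :: "complex ^ 2 ^ 2" where "M' = (\<chi> i j. if i = 1 then cnj (p $ j) else cnj (m $ j))"
  have "cnj (cinner2 p m) = 0" using assms(3) by simp
  then have "M' ** M = mat 1"
    using assms by (simp add: M_def M'_def vec_eq_iff forall_2 matrix_matrix_mult_def sum_2
        mat_def cinner2_def algebra_simps)
  then have "M ** M' = mat 1" using matrix_left_right_inverse by blast
  moreover have "M ** M' = ketbra p p + ketbra m m"
    by (simp add: M_def M'_def vec_eq_iff matrix_matrix_mult_def sum_2 ketbra_def)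
  ultimately show ?thesis by simp
qed

lemma matrix_mult_ketbra: "U ** ketbra p q = ketbra (U *v p) q"
  by (simp add: vec_eq_iff matrix_matrix_mult_def matrix_vector_mult_def ketbra_def
      sum_distrib_right mult.assoc)

lemma ketbra_mult_vec: "ketbra p q *v x = cinner2 q x *s p"
  by (simp add: vec_eq_iff matrix_vector_mult_def ketbra_def cinner2_def
      sum_distrib_left mult_ac)

text \<open>Expand \<open>U\<close> in its eigenprojections and subtract \<open>cos w\<close> times
  the resolution of the identity. Where \<open>sin w\<close> is nonzero, this expresses the
  difference of the projections by \<open>U\<close> alone, whatever eigenvectors were
  chosen.\<close>

lemma eigenprojection_difference:
  assumes on: "cinner2 p p = 1" "cinner2 m m = 1" "cinner2 p m = 0"
    and U: "U *v p = cis w *s p" "U *v m = cis (- w) *s m"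
  shows "U $ i $ j - mat (of_real (cos w)) $ i $ j
    = \<i> * of_real (sin w) * (ketbra p p - ketbra m m) $ i $ j"
proof -
  note res = orthonormal_resolution[OF on]
  have "U = U ** (ketbra p p + ketbra m m)" by (simp add: res)
  also have "\<dots> = ketbra (cis w *s p) p + ketbra (cis (- w) *s m) m"
    by (simp add: matrix_add_ldistrib matrix_mult_ketbra U)
  finally have "U $ i $ j = cis w * ketbra p p $ i $ j + cis (- w) * ketbra m m $ i $ j"
    by (simp add: ketbra_def)
  moreover have "mat (of_real (cos w)) $ i $ j
      = of_real (cos w) * (ketbra p p $ i $ j + ketbra m m $ i $ j)"
    using arg_cong[OF res, of "\<lambda>M. M $ i $ j"] by (simp add: mat_def)
  moreover have "cis w = of_real (cos w) + \<i> * of_real (sin w)"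
    "cis (- w) = of_real (cos w) - \<i> * of_real (sin w)"
    by (simp_all add: complex_eq_iff)
  ultimately show ?thesis by (simp add: ring_distribs)
qed

lemma norm_spinor_square: "cinner2 x x = of_real ((norm x)\<^sup>2)"
  by (simp add: cinner2_def norm_vec_def L2_set_def sum_2 complex_norm_square mult.commute
      del: of_real_power)

lemma norm_eq_1_spinor:
  assumes "cinner2 x x = 1"
  shows "norm x = 1"
proof -
  have "(norm x)\<^sup>2 = 1"
    using assms unfolding norm_spinor_square of_real_eq_1_iff .
  then have "sqrt ((norm x)\<^sup>2) = 1" by simp
  then show ?thesis by simp
qed

text \<open>A crude form of Cauchy-Schwarz: each of the two coordinates is bounded by the full norm.
  Only some finite constant is wanted.\<close>

lemma cinner2_bound: "cmod (cinner2 x y) \<le> 2 * (norm x * norm y)"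
proof -
  have "cmod (cinner2 x y) \<le> (\<Sum>i\<in>(UNIV :: 2 set). cmod (x $ i) * cmod (y $ i))"
    unfolding cinner2_def by (rule order_trans[OF norm_sum]) (simp add: norm_mult)
  also have "\<dots> \<le> (\<Sum>i\<in>(UNIV :: 2 set). norm x * norm y)"
    by (intro sum_mono mult_mono Finite_Cartesian_Product.norm_nth_le) auto
  finally show ?thesis by simp
qed

text \<open>\<open>P\<close> is the reflection with eigenvalue 1 on \<open>p\<close> and -1 on
  \<open>m\<close>, hence an involution. The constant 4 adds up the two factors 2 of
  \<open>cinner2_bound\<close>.\<close>

lemma ketbra_difference_square:
  assumes on: "cinner2 p p = 1" "cinner2 m m = 1" "cinner2 p m = 0"
  defines "P \<equiv> ketbra p p - ketbra m m"
  shows "P *v p = p" "P *v m = - m" "P *v (P *v x) = x" "norm (P *v x) \<le> 4 * norm x"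
proof -
  have mp: "cinner2 m p = 0"
    using arg_cong[OF on(3), of cnj] by (simp add: cinner2_def algebra_simps)
  show Pp: "P *v p = p" and Pm: "P *v m = - m"
    by (simp_all add: P_def matrix_vector_mult_diff_rdistrib ketbra_mult_vec on mp)
  have "(ketbra p p + ketbra m m) *v x = x" by (simp add: orthonormal_resolution[OF on])
  then have x: "x = cinner2 p x *s p + cinner2 m x *s m"
    by (simp add: matrix_vector_mult_add_rdistrib ketbra_mult_vec)
  have Px: "P *v x = cinner2 p x *s p - cinner2 m x *s m"
    by (simp add: P_def matrix_vector_mult_diff_rdistrib ketbra_mult_vec)
  show "P *v (P *v x) = x"
    unfolding Px by (simp add: matrix_vector_mult_diff_distrib matrix_vector_mult_smult Pp Pm x[symmetric]
        vector_smult_rneg)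
  have n1: "norm p = 1" "norm m = 1"
    using on norm_eq_1_spinor by blast+
  have "norm (P *v x) \<le> cmod (cinner2 p x) + cmod (cinner2 m x)"
    unfolding Px by (rule order_trans[OF norm_triangle_ineq4]) (simp add: norm_vector_smult n1)
  then show "norm (P *v x) \<le> 4 * norm x"
    using cinner2_bound[of p x] cinner2_bound[of m x] n1 by simp
qed

section \<open>The range of the velocities\<close>

lemma tau_le:
  assumes "a \<ge> 0" "b \<ge> 0"
  shows "\<bar>tau a b k\<bar> \<le> a + b"
proof -
  have "\<bar>a * cos (l1 k)\<bar> \<le> a" "\<bar>b * cos (l2 k)\<bar> \<le> b"
    using assms by (auto simp: abs_mult intro!: mult_left_le)
  then show ?thesis unfolding tau_def by linarith
qed

text \<open>The angles are free so that both components are covered: the second one arises from the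
  first by changing the sign of \<open>y\<close>.\<close>

lemma velocity_numerator_le:
  fixes a b x y :: real
  assumes ab: "a \<ge> 0" "b \<ge> 0" "a + b \<le> 1"
  shows "(a * sin x + b * sin y)\<^sup>2 \<le> (a + b)\<^sup>2 * (1 - (a * cos x - b * cos y)\<^sup>2)"
proof -
  have "(a + b)\<^sup>2 * (a * cos x - b * cos y)\<^sup>2 \<le> 1 * (a * cos x - b * cos y)\<^sup>2"
    using ab by (intro mult_right_mono power_le_one) auto
  moreover have "(a + b)\<^sup>2 - (a * cos x - b * cos y)\<^sup>2 - (a * sin x + b * sin y)\<^sup>2
      = 2 * a * b * (1 + cos (x + y))"
  proof -
    have "(a * cos x - b * cos y)\<^sup>2 + (a * sin x + b * sin y)\<^sup>2
      = a\<^sup>2 * ((sin x)\<^sup>2 + (cos x)\<^sup>2) + b\<^sup>2 * ((sin y)\<^sup>2 + (cos y)\<^sup>2) - 2 * a * b * cos (x + y)"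
      unfolding cos_add by algebra
    also have "\<dots> = a\<^sup>2 + b\<^sup>2 - 2 * a * b * cos (x + y)"
      by (simp only: sin_cos_squared_add mult_1_right)
    finally show ?thesis by (simp add: power2_sum ring_distribs)
  qed
  moreover have "0 \<le> 2 * a * b * (1 + cos (x + y))"
    using ab cos_ge_minus_one[of "x + y"] by (intro mult_nonneg_nonneg) linarith+
  ultimately show ?thesis by (simp add: algebra_simps)
qed

lemma regular_sqrt_pos:
  assumes "(a, b) \<in> Delta" "k \<in> regular_points a b"
  shows "sqrt (1 - (tau a b k)\<^sup>2) > 0"
proof -
  have "\<bar>tau a b k\<bar> \<le> 1" using tau_le[of a b k] assms by (auto simp: Delta_def)
  then have "(tau a b k)\<^sup>2 \<le> 1" by (simp add: abs_square_le_1)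
  then show ?thesis using assms(2) by (auto simp: regular_points_def)
qed

text \<open>Singular points are included, since the velocity is 0 there by \<open>x / 0 = 0\<close>.
  The bounds for the multiplier and for the resolvent rely on this estimate at all points.\<close>

lemma velocity_le:
  assumes ab: "(a, b) \<in> Delta"
  shows "\<bar>velocity a b j k\<bar> \<le> a + b"
proof (cases "tau a b k ^ 2 = 1")
  case True
  then show ?thesis using ab by (auto simp: velocity_def Delta_def)
next
  case False
  have ab': "a \<ge> 0" "b \<ge> 0" "a + b \<le> 1" using ab by (auto simp: Delta_def)
  define S where "S = sqrt (1 - (tau a b k)\<^sup>2)"
  have "\<bar>tau a b k\<bar> \<le> 1" using tau_le[of a b k] ab' by auto
  then have S2: "S\<^sup>2 = 1 - (tau a b k)\<^sup>2" "S > 0"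
    using False by (auto simp: S_def abs_square_le_1 order.strict_iff_order)
  have bound: "\<bar>- n / S\<bar> \<le> a + b" if "n\<^sup>2 \<le> (a + b)\<^sup>2 * S\<^sup>2" for n
  proof -
    have "\<bar>n\<bar> \<le> \<bar>(a + b) * S\<bar>"
      using that by (simp add: abs_le_square_iff power_mult_distrib)
    also have "\<dots> = (a + b) * S" using ab' S2(2) by simp
    finally show ?thesis using S2(2) by (simp add: abs_divide field_simps)
  qed
  have n: "(a * sin (l1 k) + b * sin (l2 k))\<^sup>2 \<le> (a + b)\<^sup>2 * S\<^sup>2"
    "(a * sin (l1 k) - b * sin (l2 k))\<^sup>2 \<le> (a + b)\<^sup>2 * S\<^sup>2"
    using velocity_numerator_le[OF ab', of "l1 k" "l2 k"]
      velocity_numerator_le[OF ab', of "l1 k" "- l2 k"]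
    by (simp_all add: S2 tau_def)
  show ?thesis
    using bound[OF n(1)] bound[OF n(2)]
    by (cases "j = 1") (simp_all only: velocity_def S_def if_True if_False refl)
qed

text \<open>With the \<open>j\<close>-th coordinate zero, \<open>l1\<close> is \<open>t\<close> and
  \<open>l2\<close> is \<open>t\<close> for \<open>j = 1\<close> and \<open>- t\<close> for
  \<open>j = 2\<close>. In both cases the two sine terms of the numerator add up.\<close>

definition extremal_path :: "2 \<Rightarrow> real \<Rightarrow> real ^ 2" where
  "extremal_path j t = (\<chi> i. if i = j then 0 else t)"

lemma path_velocity:
  "tau a b (extremal_path j t) = (a - b) * cos t"
  "velocity a b j (extremal_path j t) = - ((a + b) * sin t) / sqrt (1 - ((a - b) * cos t)\<^sup>2)"
proof -
  have c: "j = 1 \<or> j = 2" using exhaust_2 by blast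
  show t: "tau a b (extremal_path j t) = (a - b) * cos t"
    using c by (auto simp: tau_def l1_def l2_def extremal_path_def algebra_simps)
  show "velocity a b j (extremal_path j t) = - ((a + b) * sin t) / sqrt (1 - ((a - b) * cos t)\<^sup>2)"
    unfolding velocity_def t using c
    by (auto simp: l1_def l2_def extremal_path_def algebra_simps)
qed

lemma path_torus: "0 \<le> t \<Longrightarrow> t \<le> pi / 2 \<Longrightarrow> extremal_path j t \<in> torus"
  using pi_gt_zero by (auto simp: torus_def extremal_path_def intro: le_less_trans[of t "pi / 2"])

text \<open>At \<open>pi / 2\<close> the cosine and with it \<open>tau\<close> vanish, so the
  endpoint is regular even for \<open>(1, 0)\<close> and \<open>(0, 1)\<close>.\<close>

lemma velocity_max_attained:
  "extremal_path j (pi / 2) \<in> regular_points a b"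
  "velocity a b j (extremal_path j (pi / 2)) = - (a + b)"
  by (simp_all add: regular_points_def path_torus path_velocity)

lemma vmax_eq:
  assumes ab: "(a, b) \<in> Delta"
  shows "vmax a b = a + b"
proof -
  have "(GREATEST s. s \<in> (\<lambda>k. \<bar>velocity a b j k\<bar>) ` regular_points a b) = a + b" for j
  proof (rule Greatest_equality)
    have "\<bar>velocity a b j (extremal_path j (pi / 2))\<bar> = a + b"
      using ab by (simp add: velocity_max_attained Delta_def)
    then show "a + b \<in> (\<lambda>k. \<bar>velocity a b j k\<bar>) ` regular_points a b"
      using velocity_max_attained(1) by (metis imageI)
  qed (use velocity_le[OF ab] in auto)
  then show ?thesis by (simp add: vmax_def)
qed

lemma velocity_surj:
  assumes ab: "(a, b) \<in> Delta" "(a, b) \<noteq> (1, 0)" "(a, b) \<noteq> (0, 1)"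
    and y: "0 \<le> y" "y \<le> a + b"
  obtains k where "k \<in> regular_points a b" "velocity a b j k = - y"
proof -
  \<comment> \<open>Within \<open>Delta\<close>, the value \<open>\<bar>a - b\<bar> = 1\<close>
    occurs only at the two excluded corners; away from them the whole path is regular.\<close>
  have "\<bar>a - b\<bar> < 1" using ab by (auto simp: Delta_def abs_real_def)
  have "\<bar>(a - b) * cos t\<bar> < 1" for t
  proof -
    have "\<bar>(a - b) * cos t\<bar> \<le> \<bar>a - b\<bar>" by (simp add: abs_mult mult_left_le)
    with \<open>\<bar>a - b\<bar> < 1\<close> show ?thesis by linarith
  qed
  then have lt: "((a - b) * cos t)\<^sup>2 < 1" for t by (simp add: abs_square_less_1)
  then have ne: "((a - b) * cos t)\<^sup>2 \<noteq> 1" for t by (metis less_irrefl)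
  define g where "g t = - velocity a b j (extremal_path j t)" for t
  have "continuous_on {0..pi / 2} g"
    unfolding g_def path_velocity using ne by (intro continuous_intros) auto
  moreover have "g 0 \<le> y" "y \<le> g (pi / 2)"
    using y by (simp_all add: g_def path_velocity)
  ultimately obtain t where t: "0 \<le> t" "t \<le> pi / 2" "g t = y"
    using IVT'[of g 0 y "pi / 2"] by auto
  show ?thesis
  proof
    show "extremal_path j t \<in> regular_points a b"
      using path_torus[OF t(1,2)] ne by (simp add: regular_points_def path_velocity)
    show "velocity a b j (extremal_path j t) = - y" using t(3) by (simp add: g_def)
  qed
qed

section \<open>The velocity operator\<close>

text \<open>Both sides vanish at the singular points, because \<open>x / 0 = 0\<close>.\<close>

lemma velocity_op_entry:
  assumes ab: "(a, b) \<in> Delta" "a = a1 * a2" "b = compl_par a1 * compl_par a2"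
    and eb: "walk_eigenbasis a1 a2 \<psi>p \<psi>m" and k: "k \<in> torus"
  shows "(velocity a b j k *\<^sub>R (ketbra (\<psi>p k) (\<psi>p k) - ketbra (\<psi>m k) (\<psi>m k))) $ i $ l
    = of_real (velocity a b j k / sqrt (1 - (tau a b k)\<^sup>2))
      * (- \<i> * (walk a1 a2 k $ i $ l - mat (of_real (tau a b k)) $ i $ l))"
proof (cases "tau a b k ^ 2 = 1")
  case True
  then show ?thesis by (simp add: velocity_def)
next
  case False
  then have S: "sqrt (1 - (tau a b k)\<^sup>2) > 0"
    using regular_sqrt_pos[OF ab(1)] k by (simp add: regular_points_def)
  have "\<bar>tau a b k\<bar> \<le> 1" using tau_le[of a b k] ab(1) by (auto simp: Delta_def)
  then have w: "cos (omega a b k) = tau a b k" "sin (omega a b k) = sqrt (1 - (tau a b k)\<^sup>2)"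
    by (simp_all add: omega_def cos_arccos_abs sin_arccos_abs)
  have "walk a1 a2 k $ i $ l - mat (of_real (cos (omega a b k))) $ i $ l
      = \<i> * of_real (sin (omega a b k)) * (ketbra (\<psi>p k) (\<psi>p k) - ketbra (\<psi>m k) (\<psi>m k)) $ i $ l"
    using eb k ab(2,3) unfolding walk_eigenbasis_def Let_def
    by (intro eigenprojection_difference) auto
  then have e: "walk a1 a2 k $ i $ l - mat (of_real (tau a b k)) $ i $ l
      = \<i> * of_real (sqrt (1 - (tau a b k)\<^sup>2))
        * (ketbra (\<psi>p k) (\<psi>p k) - ketbra (\<psi>m k) (\<psi>m k)) $ i $ l"
    unfolding w .
  show ?thesis unfolding e vector_scaleR_component scaleR_conv_of_real[where 'a = complex]
    using S by (simp del: vector_minus_component)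
qed

section \<open>Continuity and measurability of the velocity multiplier\<close>

lemma continuous_tau: "continuous_on UNIV (tau a b)"
  unfolding tau_def l1_def l2_def by (intro continuous_intros)

lemma continuous_walk_entry: "continuous_on UNIV (\<lambda>k. walk a1 a2 k $ i $ l)"
proof -
  have "i = 1 \<or> i = 2" "l = 1 \<or> l = 2" using exhaust_2 by blast+
  then show ?thesis
    unfolding walk_def phase_shift_def
    by (elim disjE; simp add: matrix_matrix_mult_def sum_2; intro continuous_intros)
qed

lemma velocity_measurable: "velocity a b j \<in> borel_measurable borel"
proof -
  have [measurable]: "tau a b \<in> borel_measurable borel"
    by (intro borel_measurable_continuous_onI continuous_tau)
  have [measurable]: "l1 \<in> borel_measurable borel" "l2 \<in> borel_measurable borel"
    unfolding l1_def l2_def by (intro borel_measurable_continuous_onI continuous_intros)+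
  show ?thesis unfolding velocity_def by (cases "j = 1") simp_all
qed

text \<open>Continuity is inherited from the right-hand side of \<open>velocity_op_entry\<close>,
  which is free of eigenvectors. It is claimed only within the torus because
  \<open>walk_eigenbasis\<close> constrains the eigenvectors only there.\<close>

lemma velocity_op_continuous:
  assumes ab: "(a, b) \<in> Delta" "a = a1 * a2" "b = compl_par a1 * compl_par a2"
    and eb: "walk_eigenbasis a1 a2 \<psi>p \<psi>m" and k: "k0 \<in> regular_points a b"
  shows "continuous (at k0 within torus)
    (\<lambda>k. (velocity a b j k *\<^sub>R (ketbra (\<psi>p k) (\<psi>p k) - ketbra (\<psi>m k) (\<psi>m k))) *v w)"
    (is "continuous _ (\<lambda>k. ?V k *v w)")
proof -
  have k0: "k0 \<in> torus" using k by (simp add: regular_points_def)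
  have S: "sqrt (1 - (tau a b k0)\<^sup>2) \<noteq> 0" using regular_sqrt_pos[OF ab(1) k] by simp
  have t: "isCont (tau a b) k0" and U: "isCont (\<lambda>k. walk a1 a2 k $ i $ l) k0" for i l
    using continuous_tau continuous_walk_entry by (auto simp: continuous_on_eq_continuous_at)
  have v: "isCont (velocity a b j) k0"
    using S t unfolding velocity_def l1_def l2_def
    by (cases "j = 1") (auto intro!: continuous_intros)
  have m: "isCont (\<lambda>k. mat (of_real (tau a b k)) $ i $ l :: complex) k0" for i l :: 2
    unfolding mat_def using t by (cases "i = l") (auto intro!: continuous_intros)
  have "isCont (\<lambda>k. of_real (velocity a b j k / sqrt (1 - (tau a b k)\<^sup>2))
      * (- \<i> * (walk a1 a2 k $ i $ l - mat (of_real (tau a b k)) $ i $ l))) k0" for i l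
    by (intro continuous_intros v t U m S)
  then have "continuous (at k0 within torus) (\<lambda>k. ?V k $ i $ l)" for i l
    by (rule continuous_transform_within[OF continuous_at_imp_continuous_within zero_less_one k0])
      (simp only: velocity_op_entry[OF ab eb])
  then have "((\<lambda>k. ?V k $ i $ l) \<longlongrightarrow> ?V k0 $ i $ l) (at k0 within torus)" for i l
    unfolding continuous_within .
  then show ?thesis
    unfolding continuous_within matrix_vector_mult_def
    by (intro vec_tendstoI) (unfold vec_lambda_beta, intro tendsto_sum tendsto_mult tendsto_const)
qed

lemma velocity_op_bounded_multiplier:
  assumes ab: "(a, b) \<in> Delta" "a = a1 * a2" "b = compl_par a1 * compl_par a2"
    and eb: "walk_eigenbasis a1 a2 \<psi>p \<psi>m"
  shows "bounded_multiplier
    (\<lambda>k. velocity a b j k *\<^sub>R (ketbra (\<psi>p k) (\<psi>p k) - ketbra (\<psi>m k) (\<psi>m k)))"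
    (is "bounded_multiplier ?V")
  unfolding bounded_multiplier_def
proof (intro conjI allI exI[of _ "4 * (a + b)"] ballI)
  have nonneg: "a + b \<ge> 0" using ab(1) by (auto simp: Delta_def)
  then show "0 \<le> 4 * (a + b)" by simp
  show "norm (?V k *v x) \<le> 4 * (a + b) * norm x" if k: "k \<in> torus" for k x
  proof -
    define P where "P = ketbra (\<psi>p k) (\<psi>p k) - ketbra (\<psi>m k) (\<psi>m k)"
    have "norm (P *v x) \<le> 4 * norm x"
      using eb k unfolding walk_eigenbasis_def Let_def P_def
      by (intro ketbra_difference_square(4)) auto
    then have "\<bar>velocity a b j k\<bar> * norm (P *v x) \<le> (a + b) * (4 * norm x)"
      using velocity_le[OF ab(1)] nonneg by (intro mult_mono) auto
    then show ?thesis
      unfolding P_def[symmetric] by (simp add: scaleR_matrix_smult norm_vector_smult algebra_simps)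
  qed
  fix i l
  have [measurable]: "tau a b \<in> borel_measurable borel"
    and [measurable]: "(\<lambda>k. walk a1 a2 k $ i $ l) \<in> borel_measurable borel"
    by (intro borel_measurable_continuous_onI continuous_tau continuous_walk_entry)+
  note velocity_measurable [measurable]
  have [measurable]: "(\<lambda>k. mat (of_real (tau a b k)) $ i $ l :: complex) \<in> borel_measurable borel"
    unfolding mat_def by (cases "i = l") simp_all
  have "(\<lambda>k. of_real (velocity a b j k / sqrt (1 - (tau a b k)\<^sup>2))
      * (- \<i> * (walk a1 a2 k $ i $ l - mat (of_real (tau a b k)) $ i $ l))) \<in> borel_measurable borel"
    by measurable
  then have "(\<lambda>k. of_real (velocity a b j k / sqrt (1 - (tau a b k)\<^sup>2))
      * (- \<i> * (walk a1 a2 k $ i $ l - mat (of_real (tau a b k)) $ i $ l)))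
      \<in> borel_measurable torus_measure"
    by (rule borel_imp_torus_measurable)
  then show "(\<lambda>k. ?V k $ i $ l) \<in> borel_measurable torus_measure"
    by (subst measurable_cong[OF velocity_op_entry[OF ab eb]]) simp_all
qed

section \<open>Determination of the spectrum\<close>

lemma velocity_op_spectrum:
  assumes ab: "(a, b) \<in> Delta" "a = a1 * a2" "b = compl_par a1 * compl_par a2"
    and nz: "(a, b) \<noteq> (1, 0)" "(a, b) \<noteq> (0, 1)"
    and eb: "walk_eigenbasis a1 a2 \<psi>p \<psi>m"
  shows "L2_spectrum (velocity_op a b \<psi>p \<psi>m j) = complex_of_real ` {- (a + b) .. a + b}"
proof -
  define P where "P k = ketbra (\<psi>p k) (\<psi>p k) - ketbra (\<psi>m k) (\<psi>m k)" for k
  define V where "V k = velocity a b j k *\<^sub>R P k" for k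
  have op: "velocity_op a b \<psi>p \<psi>m j = (\<lambda>f k. V k *v f k)"
    by (intro ext) (simp add: velocity_op_def V_def P_def)
  have bm: "bounded_multiplier V"
    using velocity_op_bounded_multiplier[OF ab eb] by (simp add: V_def[abs_def] P_def)
  have on: "cinner2 (\<psi>p k) (\<psi>p k) = 1" "cinner2 (\<psi>m k) (\<psi>m k) = 1" "cinner2 (\<psi>p k) (\<psi>m k) = 0"
    if "k \<in> torus" for k
    using eb that unfolding walk_eigenbasis_def Let_def by auto
  note P = ketbra_difference_square[OF on, folded P_def]
  have VV: "V k *v (V k *v x) = of_real ((velocity a b j k)\<^sup>2) *s x" if "k \<in> torus" for k x
    using P(3)[OF that that that]
    by (simp add: V_def scaleR_matrix_smult matrix_vector_mult_smult vector_smult_assoc power2_eq_square)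
  show ?thesis
  proof (intro equalityI subsetI)
    fix z assume z: "z \<in> complex_of_real ` {- (a + b) .. a + b}"
    then obtain x where x: "z = of_real x" "\<bar>x\<bar> \<le> a + b" by auto
    \<comment> \<open>The path yields only nonpositive velocities. The sign of \<open>x\<close> is
      matched by the eigenvector: at velocity \<open>- \<bar>x\<bar>\<close>, \<open>V k\<close> has
      eigenvalue \<open>- \<bar>x\<bar>\<close> on \<open>\<psi>p k\<close> and
      \<open>\<bar>x\<bar>\<close> on \<open>\<psi>m k\<close>.\<close>
    obtain k where k: "k \<in> regular_points a b" "velocity a b j k = - \<bar>x\<bar>"
      using velocity_surj[OF ab(1) nz, of "\<bar>x\<bar>" j] x(2) by auto
    have kt: "k \<in> torus" using k(1) by (simp add: regular_points_def)
    have "\<exists>w. w \<noteq> 0 \<and> V k *v w = z *s w"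
    proof (cases "x \<le> 0")
      case True
      have "\<psi>p k \<noteq> 0" using on(1)[OF kt] by (auto simp: cinner2_def)
      then show ?thesis using True
        by (intro exI[of _ "\<psi>p k"]) (simp add: V_def scaleR_matrix_smult P(1)[OF kt kt kt] k(2) x(1))
    next
      case False
      have "\<psi>m k \<noteq> 0" using on(2)[OF kt] by (auto simp: cinner2_def)
      then show ?thesis using False
        by (intro exI[of _ "\<psi>m k"]) (simp add: V_def scaleR_matrix_smult P(2)[OF kt kt kt] k(2) x(1)
            vec_eq_iff del: scaleR_minus_left)
    qed
    then obtain w where w: "w \<noteq> 0" "V k *v w = z *s w" by blast
    have "continuous (at k within torus) (\<lambda>k. V k *v w)"
      using velocity_op_continuous[OF ab eb k(1)] by (simp add: V_def P_def)
    then show "z \<in> L2_spectrum (velocity_op a b \<psi>p \<psi>m j)"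
      unfolding op by (intro multiplier_eigenvalue_in_spectrum[OF bm kt _ w(2,1)])
  next
    fix z assume spec: "z \<in> L2_spectrum (velocity_op a b \<psi>p \<psi>m j)"
    show "z \<in> complex_of_real ` {- (a + b) .. a + b}"
    proof (rule ccontr)
      assume z: "z \<notin> complex_of_real ` {- (a + b) .. a + b}"
      \<comment> \<open>The interval is symmetric, so it contains neither \<open>z\<close> nor
        \<open>- z\<close>, and \<open>z\<^sup>2\<close> avoids the compact set \<open>S\<close> of
        squares. Its positive distance from \<open>S\<close> bounds \<open>D k\<close> away from 0
        uniformly in \<open>k\<close>.\<close>
      define S where "S = (\<lambda>v. (complex_of_real v)\<^sup>2) ` {- (a + b) .. a + b}"
      have "closed S"
        unfolding S_def by (intro compact_imp_closed compact_continuous_image continuous_intros) auto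
      moreover have "z\<^sup>2 \<notin> S"
      proof
        assume "z\<^sup>2 \<in> S"
        then obtain v where v: "v \<in> {- (a + b) .. a + b}" "z\<^sup>2 = (of_real v)\<^sup>2" by (auto simp: S_def)
        then have "z = of_real v \<or> z = of_real (- v)" by (simp add: power2_eq_iff)
        then show False using v(1) z by (auto simp: image_iff simp del: of_real_minus)
      qed
      ultimately obtain d where d: "d > 0" "\<And>y. y \<in> S \<Longrightarrow> d \<le> dist (z\<^sup>2) y"
        using separate_point_closed[of S "z\<^sup>2"] by auto
      define D where "D k = of_real ((velocity a b j k)\<^sup>2) - z\<^sup>2" for k
      have D: "d \<le> cmod (D k)" for k
      proof -
        have "of_real ((velocity a b j k)\<^sup>2) \<in> S"
          using velocity_le[OF ab(1), of j k] by (auto simp: S_def abs_le_iff)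
        from d(2)[OF this] show ?thesis by (simp add: D_def dist_norm norm_minus_commute)
      qed
      then have D0: "D k \<noteq> 0" for k using d(1) by (metis norm_zero not_le)
      \<comment> \<open>By \<open>VV\<close>, multiplying \<open>V k - z\<close> by
        \<open>V k + z\<close> gives the nonzero scalar \<open>D k\<close>. The entrywise form makes
        measurability immediate.\<close>
      define W :: "real ^ 2 \<Rightarrow> complex ^ 2 ^ 2"
        where "W k = (\<chi> i l. inverse (D k) * (V k $ i $ l + mat z $ i $ l))" for k
      have W: "W k *v x = inverse (D k) *s (V k *v x + z *s x)" for k x
        by (simp add: W_def vec_eq_iff forall_2 matrix_vector_mult_def sum_2 mat_def algebra_simps)
      have "z \<in> L2_resolvent_set (\<lambda>f k. V k *v f k)"
      proof (rule multiplier_resolvent)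
        have vanish: "inverse (D k) *s (D k *s x) = x" for k and x :: "complex ^ 2"
          using D0 by (simp add: vector_smult_assoc)
        show "W k *v (V k *v x - z *s x) = x" if "k \<in> torus" for k x
        proof -
          have "V k *v (V k *v x - z *s x) + z *s (V k *v x - z *s x) = D k *s x"
            by (simp add: matrix_vector_mult_diff_distrib VV[OF that] matrix_vector_mult_smult D_def
                vec_eq_iff algebra_simps power2_eq_square)
          then show ?thesis unfolding W by (simp only: vanish)
        qed
        show "V k *v (W k *v x) - z *s (W k *v x) = x" if "k \<in> torus" for k x
        proof -
          have "V k *v (W k *v x) - z *s (W k *v x) = inverse (D k) *s (D k *s x)"
            by (simp add: W matrix_vector_right_distrib VV[OF that] matrix_vector_mult_smult D_def
                vec_eq_iff algebra_simps power2_eq_square)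
          then show ?thesis by (simp only: vanish)
        qed
        obtain K where K: "K \<ge> 0" "\<And>k x. k \<in> torus \<Longrightarrow> norm (V k *v x) \<le> K * norm x"
          and [measurable]: "\<And>i l. (\<lambda>k. V k $ i $ l) \<in> borel_measurable torus_measure"
          using bm unfolding bounded_multiplier_def by blast
        show "bounded_multiplier W"
          unfolding bounded_multiplier_def
        proof (intro conjI allI exI[of _ "inverse d * (K + cmod z)"] ballI)
          show "0 \<le> inverse d * (K + cmod z)" using d(1) K(1) by simp
          show "norm (W k *v x) \<le> inverse d * (K + cmod z) * norm x" if "k \<in> torus" for k x
          proof -
            have "norm (V k *v x + z *s x) \<le> (K + cmod z) * norm x"
              using norm_triangle_ineq[of "V k *v x" "z *s x"] K(2)[OF that, of x]
              by (simp add: norm_vector_smult algebra_simps)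
            moreover have "cmod (inverse (D k)) \<le> inverse d"
              using D[of k] d(1) by (simp add: norm_inverse le_imp_inverse_le)
            ultimately show ?thesis
              unfolding W norm_vector_smult using d(1) by (simp only: mult.assoc) (intro mult_mono; simp)
          qed
          have [measurable]: "(\<lambda>k. D k) \<in> borel_measurable torus_measure"
          proof -
            have "velocity a b j \<in> borel_measurable torus_measure"
              by (rule borel_imp_torus_measurable[OF velocity_measurable])
            then show ?thesis unfolding D_def by simp
          qed
          show "(\<lambda>k. W k $ i $ l) \<in> borel_measurable torus_measure" for i l
            unfolding W_def by simp
        qed
      qed
      then show False using spec by (simp add: op L2_spectrum_def)
    qed
  qed
qed

theorem proposition3:
  fixes a b :: real
  assumes "(a, b) \<in> Delta"
  shows "(\<forall>j. \<exists>k \<in> regular_points a b. \<forall>k' \<in> regular_points a b.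
            \<bar>velocity a b j k'\<bar> \<le> \<bar>velocity a b j k\<bar>) \<and>
         vmax a b = a + b \<and>
         ((a, b) \<noteq> (1, 0) \<and> (a, b) \<noteq> (0, 1) \<longrightarrow>
           (\<forall>a1 \<in> {0..1}. \<forall>a2 \<in> {0..1}. \<forall>\<psi>p \<psi>m j.
              a = a1 * a2 \<and> b = compl_par a1 * compl_par a2 \<and> walk_eigenbasis a1 a2 \<psi>p \<psi>m \<longrightarrow>
              L2_spectrum (velocity_op a b \<psi>p \<psi>m j) = complex_of_real ` {- vmax a b .. vmax a b}))"
proof (intro conjI allI impI ballI)
  \<comment> \<open>The endpoint of the extremal path is a maximiser, so the \<open>GREATEST\<close>
    in \<open>vmax\<close> denotes an attained maximum.\<close>
  show "\<exists>k \<in> regular_points a b. \<forall>k' \<in> regular_points a b.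
      \<bar>velocity a b j k'\<bar> \<le> \<bar>velocity a b j k\<bar>" for j
    using velocity_le[OF assms, where j = j] assms
    by (intro bexI[OF _ velocity_max_attained(1)[where j = j]])
      (simp add: velocity_max_attained(2) Delta_def add.commute)
  show "vmax a b = a + b" by (rule vmax_eq[OF assms])
qed (use velocity_op_spectrum[OF assms] vmax_eq[OF assms] in auto)

end
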